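(* For a theory $T$, suppose the formula $\mathrm{Proof}_T(z,x)$ states that "$z$ is (the Gödel code of) the proof of a formula (with Gödel code) $x$ in $T$", and suppose that $T$ has the following properties: (a) $T\vdash\overline{i}\neq\overline{j}$ and $T\vdash\overline{n}\leqslant\overline{m}$ and $T\vdash\forall y(\overline{m}\leqslant y\rightarrow\overline{n}\leqslant y)$, for any $i,j,n,m\in\mathbb{N}$ with $i\neq j$ and $n\leqslant m$; (b) $T\vdash\forall y(y\leqslant\overline{n}\vee\overline{n}\leqslant y)$, for all $n\in\mathbb{N}$; (c) $T\vdash\forall y\big(y\leqslant\overline{n}\leftrightarrow\bigvee_{i=0}^{n}y=\overline{i}\big)$, for all $n\in\mathbb{N}$; (d) if $T\vdash\phi$ and $k$ is the Gödel code of this proof, then $T\vdash\mathrm{Proof}_T(\overline{k},\ulcorner\phi\urcorner)$; (e) if $k$ is not the Gödel code of a proof of $\phi$ in $T$, then $T\vdash\neg\mathrm{Proof}_T(\overline{k},\ulcorner\phi\urcorner)$; in particular, if $T\not\vdash\phi$, then $T\vdash\neg\mathrm{Proof}_T(\overline{l},\ulcorner\phi\urcorner)$ for any $l\in\mathbb{N}$. Then weak representability of a function $f\colon\mathbb{N}\to\mathbb{N}$ in $T$ implies its representability in $T$.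
   Context: $\mathbb{N}$ is the set of natural numbers, including $0$. The language of the theory $T$ contains the relation symbol $\leqslant$ and, for each $n\in\mathbb{N}$, a term $\overline{n}$ indicating $n$. A primitive recursive Gödel coding $\alpha\mapsto\ulcorner\alpha\urcorner$ is fixed; inside formulas of $T$, $\ulcorner\phi\urcorner$ stands for the term indicating the Gödel code of $\phi$. In (d) and (e), $\phi$ is an arbitrary formula of the language of $T$ and $k\in\mathbb{N}$. A function $f\colon\mathbb{N}\to\mathbb{N}$ is weakly representable in $T$ if for some formula $\varphi(x,y)$ we have, for every $n,m\in\mathbb{N}$: if $f(n)=m$, then $T\vdash\varphi(\overline{n},\overline{m})$; and if $f(n)\neq m$, then $T\not\vdash\varphi(\overline{n},\overline{m})$. A function $f\colon\mathbb{N}\to\mathbb{N}$ is representable in $T$ if for some formula $\psi(x,y)$ we have, for every $n,m\in\mathbb{N}$: if $f(n)=m$, then $T\vdash\psi(\overline{n},\overline{m})$; and if $f(n)\neq m$, then $T\vdash\neg\psi(\overline{n},\overline{m})$.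
   Formalization: Added hypothesis: for each formula φ(x,y), the function taking (n,m) to the Gödel code of φ(n̄,m̄) is representable in T; properties (a)–(e) alone do not suffice, since some decidable theory with (a)–(e) weakly represents 2^n without representing it. *)

theory Defs
  imports Main "HOL-Library.Nat_Bijection"
begin

section \<open>First-order logic with equality\<close>

text \<open>
  Languages are countable: symbols are natural numbers, and a language says which of them are
  function and relation symbols, and of which arity. Variables are de Bruijn indices, so that a
  formula \<open>\<phi>(x,y)\<close> is a formula whose free variables are among 0 (for \<open>x\<close>) and 1 (for \<open>y\<close>).
\<close>

datatype tm = Var nat | Fn nat "tm list"

datatype fm = Eq tm tm | Rel nat "tm list" | Neg fm | Imp fm fm | All fm

record lang =
  fun_ar :: "nat \<rightharpoonup> nat"
  rel_ar :: "nat \<rightharpoonup> nat"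

abbreviation Or :: "fm \<Rightarrow> fm \<Rightarrow> fm" where
  "Or \<phi> \<psi> \<equiv> Imp (Neg \<phi>) \<psi>"

abbreviation And :: "fm \<Rightarrow> fm \<Rightarrow> fm" where
  "And \<phi> \<psi> \<equiv> Neg (Imp \<phi> (Neg \<psi>))"

abbreviation Iff :: "fm \<Rightarrow> fm \<Rightarrow> fm" where
  "Iff \<phi> \<psi> \<equiv> And (Imp \<phi> \<psi>) (Imp \<psi> \<phi>)"

text \<open>\<open>big_or F n\<close> is \<open>F 0 \<or> \<dots> \<or> F n\<close>.\<close>

primrec big_or :: "(nat \<Rightarrow> fm) \<Rightarrow> nat \<Rightarrow> fm" where
  "big_or F 0 = F 0"
| "big_or F (Suc n) = Or (big_or F n) (F (Suc n))"

fun is_tm :: "lang \<Rightarrow> tm \<Rightarrow> bool" where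
  "is_tm L (Var i) \<longleftrightarrow> True"
| "is_tm L (Fn f ts) \<longleftrightarrow> fun_ar L f = Some (length ts) \<and> (\<forall>t\<in>set ts. is_tm L t)"

fun is_fm :: "lang \<Rightarrow> fm \<Rightarrow> bool" where
  "is_fm L (Eq s t) \<longleftrightarrow> is_tm L s \<and> is_tm L t"
| "is_fm L (Rel r ts) \<longleftrightarrow> rel_ar L r = Some (length ts) \<and> (\<forall>t\<in>set ts. is_tm L t)"
| "is_fm L (Neg \<phi>) \<longleftrightarrow> is_fm L \<phi>"
| "is_fm L (Imp \<phi> \<psi>) \<longleftrightarrow> is_fm L \<phi> \<and> is_fm L \<psi>"
| "is_fm L (All \<phi>) \<longleftrightarrow> is_fm L \<phi>"

fun fvt :: "tm \<Rightarrow> nat set" where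
  "fvt (Var i) = {i}"
| "fvt (Fn f ts) = (\<Union>t\<in>set ts. fvt t)"

fun fv :: "fm \<Rightarrow> nat set" where
  "fv (Eq s t) = fvt s \<union> fvt t"
| "fv (Rel r ts) = (\<Union>t\<in>set ts. fvt t)"
| "fv (Neg \<phi>) = fv \<phi>"
| "fv (Imp \<phi> \<psi>) = fv \<phi> \<union> fv \<psi>"
| "fv (All \<phi>) = {i. Suc i \<in> fv \<phi>}"

definition closed_tm :: "lang \<Rightarrow> tm \<Rightarrow> bool" where
  "closed_tm L t \<longleftrightarrow> is_tm L t \<and> fvt t = {}"

definition sentence :: "lang \<Rightarrow> fm \<Rightarrow> bool" where
  "sentence L \<phi> \<longleftrightarrow> is_fm L \<phi> \<and> fv \<phi> = {}"

fun subt :: "(nat \<Rightarrow> tm) \<Rightarrow> tm \<Rightarrow> tm" where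
  "subt \<sigma> (Var i) = \<sigma> i"
| "subt \<sigma> (Fn f ts) = Fn f (map (subt \<sigma>) ts)"

definition up :: "(nat \<Rightarrow> tm) \<Rightarrow> nat \<Rightarrow> tm" where
  "up \<sigma> i = (case i of 0 \<Rightarrow> Var 0 | Suc j \<Rightarrow> subt (\<lambda>k. Var (Suc k)) (\<sigma> j))"

fun sub :: "(nat \<Rightarrow> tm) \<Rightarrow> fm \<Rightarrow> fm" where
  "sub \<sigma> (Eq s t) = Eq (subt \<sigma> s) (subt \<sigma> t)"
| "sub \<sigma> (Rel r ts) = Rel r (map (subt \<sigma>) ts)"
| "sub \<sigma> (Neg \<phi>) = Neg (sub \<sigma> \<phi>)"
| "sub \<sigma> (Imp \<phi> \<psi>) = Imp (sub \<sigma> \<phi>) (sub \<sigma> \<psi>)"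
| "sub \<sigma> (All \<phi>) = All (sub (up \<sigma>) \<phi>)"

definition shift :: "fm \<Rightarrow> fm" where
  "shift \<phi> = sub (\<lambda>i. Var (Suc i)) \<phi>"

text \<open>
  \<open>inst \<phi> [t\<^sub>0, \<dots>, t\<^sub>k]\<close> replaces the variables \<open>0, \<dots>, k\<close> simultaneously by
  \<open>t\<^sub>0, \<dots>, t\<^sub>k\<close> and lowers the remaining free variables, as required when stripping quantifiers.
\<close>

definition inst :: "fm \<Rightarrow> tm list \<Rightarrow> fm" where
  "inst \<phi> ts = sub (\<lambda>i. if i < length ts then ts ! i else Var (i - length ts)) \<phi>"


section \<open>Proofs\<close>

text \<open>
  A Hilbert calculus in the style of Enderton: the logical axioms are all generalizations of the
  ones below, and modus ponens is the only rule.
\<close>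

fun holds :: "(fm \<Rightarrow> bool) \<Rightarrow> fm \<Rightarrow> bool" where
  "holds v (Neg \<phi>) \<longleftrightarrow> \<not> holds v \<phi>"
| "holds v (Imp \<phi> \<psi>) \<longleftrightarrow> (holds v \<phi> \<longrightarrow> holds v \<psi>)"
| "holds v \<phi> \<longleftrightarrow> v \<phi>"

definition tautology :: "fm \<Rightarrow> bool" where
  "tautology \<phi> \<longleftrightarrow> (\<forall>v. holds v \<phi>)"

inductive log_ax :: "lang \<Rightarrow> fm \<Rightarrow> bool" for L where
  taut: "is_fm L \<phi> \<Longrightarrow> tautology \<phi> \<Longrightarrow> log_ax L \<phi>"
| spec: "is_fm L \<phi> \<Longrightarrow> is_tm L t \<Longrightarrow> log_ax L (Imp (All \<phi>) (inst \<phi> [t]))"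
| dist: "is_fm L \<phi> \<Longrightarrow> is_fm L \<psi> \<Longrightarrow>
    log_ax L (Imp (All (Imp \<phi> \<psi>)) (Imp (All \<phi>) (All \<psi>)))"
| vacuous: "is_fm L \<phi> \<Longrightarrow> log_ax L (Imp \<phi> (All (shift \<phi>)))"
| refl: "is_tm L t \<Longrightarrow> log_ax L (Eq t t)"
| leibniz: "is_fm L \<phi> \<Longrightarrow> is_tm L s \<Longrightarrow> is_tm L t \<Longrightarrow>
    log_ax L (Imp (Eq s t) (Imp (inst \<phi> [s]) (inst \<phi> [t])))"
| gen: "log_ax L \<phi> \<Longrightarrow> log_ax L (All \<phi>)"

definition proof_of :: "lang \<Rightarrow> fm set \<Rightarrow> fm list \<Rightarrow> fm \<Rightarrow> bool" where
  "proof_of L T ps \<phi> \<longleftrightarrow> ps \<noteq> [] \<and> last ps = \<phi> \<and>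
     (\<forall>i<length ps. ps ! i \<in> T \<or> log_ax L (ps ! i) \<or>
        (\<exists>j<i. \<exists>k<i. ps ! j = Imp (ps ! k) (ps ! i)))"

definition provable :: "lang \<Rightarrow> fm set \<Rightarrow> fm \<Rightarrow> bool" where
  "provable L T \<phi> \<longleftrightarrow> (\<exists>ps. proof_of L T ps \<phi>)"


section \<open>Goedel codings\<close>

inductive primitive_recursive :: "nat \<Rightarrow> (nat list \<Rightarrow> nat) \<Rightarrow> bool" where
  zero: "primitive_recursive n (\<lambda>xs. 0)"
| succ: "primitive_recursive 1 (\<lambda>xs. Suc (xs ! 0))"
| proj: "i < n \<Longrightarrow> primitive_recursive n (\<lambda>xs. xs ! i)"
| comp: "primitive_recursive (length gs) h \<Longrightarrow> (\<And>g. g \<in> set gs \<Longrightarrow> primitive_recursive n g) \<Longrightarrow>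
    primitive_recursive n (\<lambda>xs. h (map (\<lambda>g. g xs) gs))"
| prec: "primitive_recursive n g \<Longrightarrow> primitive_recursive (Suc (Suc n)) h \<Longrightarrow>
    primitive_recursive (Suc n)
      (\<lambda>xs. rec_nat (g (tl xs)) (\<lambda>k r. h (k # r # tl xs)) (hd xs))"

fun std_tm :: "tm \<Rightarrow> nat" where
  "std_tm (Var i) = prod_encode (0, i)"
| "std_tm (Fn f ts) = prod_encode (1, prod_encode (f, list_encode (map std_tm ts)))"

fun std_fm :: "fm \<Rightarrow> nat" where
  "std_fm (Eq s t) = prod_encode (0, prod_encode (std_tm s, std_tm t))"
| "std_fm (Rel r ts) = prod_encode (1, prod_encode (r, list_encode (map std_tm ts)))"
| "std_fm (Neg \<phi>) = prod_encode (2, std_fm \<phi>)"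
| "std_fm (Imp \<phi> \<psi>) = prod_encode (3, prod_encode (std_fm \<phi>, std_fm \<psi>))"
| "std_fm (All \<phi>) = prod_encode (4, std_fm \<phi>)"

definition std_fms :: "fm list \<Rightarrow> nat" where
  "std_fms ps = list_encode (map std_fm ps)"

text \<open>
  A primitive recursive Goedel coding of the formulas (\<open>gn\<close>) and of the finite sequences of
  formulas (\<open>pn\<close>) of the language. That a map from syntactic objects to numbers is primitive
  recursive means that it is so when these objects are presented by their standard codes.
\<close>

definition goedel_coding :: "lang \<Rightarrow> (fm \<Rightarrow> nat) \<Rightarrow> (fm list \<Rightarrow> nat) \<Rightarrow> bool" where
  "goedel_coding L gn pn \<longleftrightarrow>
     inj_on gn {\<phi>. is_fm L \<phi>} \<and> inj_on pn {ps. \<forall>\<phi>\<in>set ps. is_fm L \<phi>} \<and>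
     (\<exists>h. primitive_recursive 1 h \<and> (\<forall>\<phi>. is_fm L \<phi> \<longrightarrow> gn \<phi> = h [std_fm \<phi>])) \<and>
     (\<exists>h. primitive_recursive 1 h \<and>
        (\<forall>ps. (\<forall>\<phi>\<in>set ps. is_fm L \<phi>) \<longrightarrow> pn ps = h [std_fms ps]))"

definition codes_proof :: "lang \<Rightarrow> fm set \<Rightarrow> (fm list \<Rightarrow> nat) \<Rightarrow> nat \<Rightarrow> fm \<Rightarrow> bool" where
  "codes_proof L T pn k \<phi> \<longleftrightarrow> (\<exists>ps. proof_of L T ps \<phi> \<and> pn ps = k)"


section \<open>Representability\<close>

text \<open>In the following, \<open>num n\<close> is the term indicating \<open>n\<close>.\<close>

definition weakly_representable ::
  "lang \<Rightarrow> fm set \<Rightarrow> (nat \<Rightarrow> tm) \<Rightarrow> (nat \<Rightarrow> nat) \<Rightarrow> bool" where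
  "weakly_representable L T num f \<longleftrightarrow>
     (\<exists>\<phi>. is_fm L \<phi> \<and> fv \<phi> \<subseteq> {0, 1} \<and>
        (\<forall>n m. (f n = m \<longrightarrow> provable L T (inst \<phi> [num n, num m])) \<and>
               (f n \<noteq> m \<longrightarrow> \<not> provable L T (inst \<phi> [num n, num m]))))"

definition representable ::
  "lang \<Rightarrow> fm set \<Rightarrow> (nat \<Rightarrow> tm) \<Rightarrow> (nat \<Rightarrow> nat) \<Rightarrow> bool" where
  "representable L T num f \<longleftrightarrow>
     (\<exists>\<psi>. is_fm L \<psi> \<and> fv \<psi> \<subseteq> {0, 1} \<and>
        (\<forall>n m. (f n = m \<longrightarrow> provable L T (inst \<psi> [num n, num m])) \<and>
               (f n \<noteq> m \<longrightarrow> provable L T (Neg (inst \<psi> [num n, num m])))))"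

text \<open>The same notion for functions of two arguments.\<close>

definition representable2 ::
  "lang \<Rightarrow> fm set \<Rightarrow> (nat \<Rightarrow> tm) \<Rightarrow> (nat \<Rightarrow> nat \<Rightarrow> nat) \<Rightarrow> bool" where
  "representable2 L T num g \<longleftrightarrow>
     (\<exists>\<psi>. is_fm L \<psi> \<and> fv \<psi> \<subseteq> {0, 1, 2} \<and>
        (\<forall>n m c. (g n m = c \<longrightarrow> provable L T (inst \<psi> [num n, num m, num c])) \<and>
                 (g n m \<noteq> c \<longrightarrow> provable L T (Neg (inst \<psi> [num n, num m, num c])))))"

text \<open>
  The usual convention that \<open>Proof\<^sub>T(z, \<ulcorner>\<phi>(x,y)\<urcorner>)\<close> may be used as a formula with free variables
  \<open>x\<close>, \<open>y\<close>, \<open>z\<close>: the function taking \<open>n\<close>, \<open>m\<close> to the code of \<open>\<phi>(n,m)\<close>, with numerals put for the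
  variables, is representable in \<open>T\<close>. This is part of what a primitive recursive coding is for, but
  it does not follow from the coding being primitive recursive unless \<open>T\<close> represents enough
  primitive recursive functions. The theorem fails without it.
\<close>

definition instances_expressible ::
  "lang \<Rightarrow> fm set \<Rightarrow> (nat \<Rightarrow> tm) \<Rightarrow> (fm \<Rightarrow> nat) \<Rightarrow> bool" where
  "instances_expressible L T num gn \<longleftrightarrow>
     (\<forall>\<phi>. is_fm L \<phi> \<and> fv \<phi> \<subseteq> {0, 1} \<longrightarrow>
        representable2 L T num (\<lambda>n m. gn (inst \<phi> [num n, num m])))"

end

theory Submission
  imports Defs
begin

text \<open>
  Let \<open>\<phi>\<close> weakly represent \<open>f\<close> and let \<open>G(x,y,c)\<close> represent \<open>(n,m) \<mapsto> \<ulcorner>\<phi>(n,m)\<urcorner>\<close>. Put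
  \<open>S(x,y,z) = \<exists>u\<le>z. \<exists>c\<le>z. G(x,y,c) \<and> Prf(u,c)\<close>. The bound on \<open>c\<close> matters: \<open>T\<close> refutes
  \<open>G(n,m,c)\<close> for each wrong numeral \<open>c\<close>, but not for all other \<open>c\<close> at once. Then the Rosser-style
  formula \<open>\<psi>(x,y) = \<exists>z. S(x,y,z) \<and> (\<forall>y'\<le>z. S(x,y',z) \<longrightarrow> y' = y)\<close> represents \<open>f\<close>. For let \<open>w\<close>
  bound \<open>f(n)\<close>, the code of \<open>\<phi>(n,f(n))\<close> and the code of a proof of it. Then \<open>T\<close> proves
  \<open>S(n,f(n),z)\<close> whenever \<open>z \<ge> w\<close>, while it refutes \<open>S(n,m,i)\<close> for all numerals \<open>i\<close> if
  \<open>m \<noteq> f(n)\<close>. So \<open>z = w\<close> witnesses \<open>\<psi>(n,f(n))\<close>; and if \<open>m \<noteq> f(n)\<close>, a witness \<open>z\<close> for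
  \<open>\<psi>(n,m)\<close> is refuted by its first conjunct if \<open>z \<le> w\<close>, by its second one if \<open>w \<le> z\<close>.
\<close>

section \<open>Substitution\<close>

text \<open>A name for the renaming inside \<open>up\<close>, so that the simplifier rewrites with
  it as a unit instead of unfolding it.\<close>

definition lift :: "tm \<Rightarrow> tm" where
  "lift = subt (\<lambda>k. Var (Suc k))"

text \<open>The substitution behind \<open>inst\<close> for a one-element list, in a form that
  computes on \<open>0\<close> and \<open>Suc j\<close>.\<close>

definition point :: "tm \<Rightarrow> nat \<Rightarrow> tm" where
  "point t i = (case i of 0 \<Rightarrow> t | Suc j \<Rightarrow> Var j)"

lemma point_simps [simp]: "point t 0 = t" "point t (Suc j) = Var j"
  by (simp_all add: point_def)

lemma up_simps [simp]: "up \<sigma> 0 = Var 0" "up \<sigma> (Suc j) = lift (\<sigma> j)"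
  by (simp_all add: up_def lift_def)

lemma lift_Var [simp]: "lift (Var i) = Var (Suc i)"
  by (simp add: lift_def)

lemma inst_single: "inst \<phi> [t] = sub (point t) \<phi>"
proof -
  have "(\<lambda>i. if i < length [t] then [t] ! i else Var (i - length [t])) = point t"
    by (auto simp: fun_eq_iff point_def split: nat.split)
  then show ?thesis by (simp add: inst_def)
qed

lemma subt_cong: "(\<And>i. i \<in> fvt t \<Longrightarrow> \<sigma> i = \<tau> i) \<Longrightarrow> subt \<sigma> t = subt \<tau> t"
  by (induction t) auto

lemma sub_cong: "(\<And>i. i \<in> fv \<phi> \<Longrightarrow> \<sigma> i = \<tau> i) \<Longrightarrow> sub \<sigma> \<phi> = sub \<tau> \<phi>"
proof (induction \<phi> arbitrary: \<sigma> \<tau>)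
  case (All \<phi>)
  have "up \<sigma> i = up \<tau> i" if "i \<in> fv \<phi>" for i
    using that All.prems by (cases i) auto
  then have "sub (up \<sigma>) \<phi> = sub (up \<tau>) \<phi>" by (rule All.IH)
  then show ?case by simp
next
  case (Eq s t)
  then have "subt \<sigma> s = subt \<tau> s" "subt \<sigma> t = subt \<tau> t"
    by (simp_all add: subt_cong[of _ \<sigma> \<tau>])
  then show ?case by simp
next
  case (Rel r ts)
  then have "subt \<sigma> t = subt \<tau> t" if "t \<in> set ts" for t
    using that by (intro subt_cong) auto
  then show ?case by simp
next
  case (Neg \<phi>)
  from Neg.IH[of \<sigma> \<tau>] Neg.prems show ?case by simp
next
  case (Imp \<phi> \<psi>)
  from Imp.IH[of \<sigma> \<tau>] Imp.prems show ?case by simp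
qed

lemma subt_subt: "subt \<sigma> (subt \<tau> t) = subt (\<lambda>i. subt \<sigma> (\<tau> i)) t"
  by (induction t) auto

text \<open>A lifted term avoids variable 0, so only the successor case of \<open>up\<close> is
  reached.\<close>

lemma subt_up_lift [simp]: "subt (up \<sigma>) (lift t) = lift (subt \<sigma> t)"
  by (simp add: lift_def subt_subt up_def)

lemma subt_Var: "subt Var t = t"
  by (induction t) (auto simp: map_idI)

lemma subt_point_lift [simp]: "subt (point t) (lift s) = s"
  by (simp add: lift_def subt_subt subt_Var)

lemma up_comp: "(\<lambda>i. subt (up \<sigma>) (up \<tau> i)) = up (\<lambda>i. subt \<sigma> (\<tau> i))"
proof
  show "subt (up \<sigma>) (up \<tau> i) = up (\<lambda>i. subt \<sigma> (\<tau> i)) i" for i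
    by (cases i) auto
qed

lemma sub_sub: "sub \<sigma> (sub \<tau> \<phi>) = sub (\<lambda>i. subt \<sigma> (\<tau> i)) \<phi>"
  by (induction \<phi> arbitrary: \<sigma> \<tau>) (auto simp: subt_subt up_comp)

lemma up_Var: "up Var = Var"
proof
  show "up Var i = Var i" for i by (cases i) auto
qed

lemma sub_Var: "sub Var \<phi> = \<phi>"
  by (induction \<phi>) (auto simp: subt_Var up_Var map_idI)

lemma subt_closed: "fvt t = {} \<Longrightarrow> subt \<sigma> t = t"
  using subt_cong[of t \<sigma> Var] by (simp add: subt_Var)

lemma sub_closed: "fv \<phi> = {} \<Longrightarrow> sub \<sigma> \<phi> = \<phi>"
  using sub_cong[of \<phi> \<sigma> Var] by (simp add: sub_Var)

text \<open>The bound on the free variables is essential: any variable beyond \<open>ts\<close>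
  would be lowered by \<open>inst\<close> and then also hit by the substitution.\<close>

lemma sub_inst:
  "fv \<phi> \<subseteq> {..<length ts} \<Longrightarrow> sub \<sigma> (inst \<phi> ts) = inst \<phi> (map (subt \<sigma>) ts)"
  unfolding inst_def sub_sub by (rule sub_cong) auto

section \<open>Well-formedness and free variables under substitution\<close>

lemma is_tm_subt: "is_tm L t \<Longrightarrow> (\<And>i. is_tm L (\<sigma> i)) \<Longrightarrow> is_tm L (subt \<sigma> t)"
  by (induction t) auto

lemma is_tm_lift [simp]: "is_tm L t \<Longrightarrow> is_tm L (lift t)"
  by (simp add: lift_def is_tm_subt)

lemma is_fm_sub: "is_fm L \<phi> \<Longrightarrow> (\<And>i. is_tm L (\<sigma> i)) \<Longrightarrow> is_fm L (sub \<sigma> \<phi>)"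
proof (induction \<phi> arbitrary: \<sigma>)
  case (All \<phi>)
  have "is_tm L (up \<sigma> i)" for i
    using All.prems by (cases i) auto
  then show ?case using All by auto
qed (auto simp: is_tm_subt)

lemma is_fm_inst: "is_fm L \<phi> \<Longrightarrow> (\<And>t. t \<in> set ts \<Longrightarrow> is_tm L t) \<Longrightarrow> is_fm L (inst \<phi> ts)"
  unfolding inst_def by (rule is_fm_sub) auto

lemma fvt_subt: "fvt (subt \<sigma> t) = (\<Union>i\<in>fvt t. fvt (\<sigma> i))"
  by (induction t) auto

lemma fvt_lift: "fvt (lift t) = Suc ` fvt t"
  by (auto simp: lift_def fvt_subt)

lemma fv_sub: "fv (sub \<sigma> \<phi>) = (\<Union>i\<in>fv \<phi>. fvt (\<sigma> i))"
proof (induction \<phi> arbitrary: \<sigma>)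
  case (All \<phi>)
  \<comment> \<open>The bound variable contributes nothing, since \<open>up\<close> maps 0 to
    \<open>Var 0\<close>; all other variables contribute lifted terms.\<close>
  have "Suc i \<in> fvt (up \<sigma> j) \<longleftrightarrow> (\<exists>k. j = Suc k \<and> i \<in> fvt (\<sigma> k))" for i j
    by (cases j) (auto simp: fvt_lift)
  then show ?case by (auto simp: All.IH)
qed (auto simp: fvt_subt)

lemma fv_inst:
  assumes "fv \<phi> \<subseteq> {..<length ts}"
  shows "fv (inst \<phi> ts) \<subseteq> (\<Union>t\<in>set ts. fvt t)"
  using assms unfolding inst_def fv_sub by fastforce

section \<open>Derivations\<close>

abbreviation Exists :: "fm \<Rightarrow> fm" where
  "Exists \<phi> \<equiv> Neg (All (Neg \<phi>))"

lemma provable_ax: "\<phi> \<in> T \<or> log_ax L \<phi> \<Longrightarrow> provable L T \<phi>"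
  unfolding provable_def proof_of_def by (intro exI[of _ "[\<phi>]"]) auto

text \<open>Concatenate the two proofs and append the conclusion. Steps of the first keep their
  positions, those of the second move by \<open>length ps\<close>.\<close>

lemma provable_mp:
  assumes "provable L T (Imp \<phi> \<psi>)" "provable L T \<phi>"
  shows "provable L T \<psi>"
proof -
  let ?step = "\<lambda>ps i. ps ! i \<in> T \<or> log_ax L (ps ! i) \<or>
    (\<exists>j<i. \<exists>k<i. ps ! j = Imp (ps ! k) (ps ! i))"
  obtain ps where ps: "ps \<noteq> []" "last ps = Imp \<phi> \<psi>" "\<And>i. i < length ps \<Longrightarrow> ?step ps i"
    using assms(1) unfolding provable_def proof_of_def by blast
  obtain qs where qs: "qs \<noteq> []" "last qs = \<phi>" "\<And>i. i < length qs \<Longrightarrow> ?step qs i"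
    using assms(2) unfolding provable_def proof_of_def by blast
  let ?rs = "ps @ qs @ [\<psi>]"
  have "?step ?rs i" if "i < length ?rs" for i
  proof -
    consider "i < length ps" | i' where "i = length ps + i'" "i' < length qs"
      | "i = length ps + length qs"
    proof (cases "i < length ps")
      case False
      then obtain i' where "i = length ps + i'"
        using le_Suc_ex not_less by blast
      then show ?thesis using that \<open>i < length ?rs\<close> by (auto simp: less_Suc_eq)
    qed auto
    then show ?thesis
    proof cases
      case 1
      then have nth: "?rs ! j = ps ! j" if "j \<le> i" for j
        using that by (simp add: nth_append)
      from ps(3)[OF 1] show ?thesis
        using nth[OF order.refl] nth[OF less_imp_le] by metis
    next
      case 2
      have nth: "?rs ! (length ps + j) = qs ! j" if "j < length qs" for j
        using that by (simp add: nth_append)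
      from qs(3)[OF 2(2)] consider "qs ! i' \<in> T \<or> log_ax L (qs ! i')"
        | j k where "j < i'" "k < i'" "qs ! j = Imp (qs ! k) (qs ! i')"
        by blast
      then show ?thesis
      proof cases
        case 1
        then show ?thesis using nth[OF 2(2)] 2(1) by metis
      next
        case (2 j k)
        have "?rs ! (length ps + j) = Imp (?rs ! (length ps + k)) (?rs ! i)"
          using 2 nth \<open>i = length ps + i'\<close> \<open>i' < length qs\<close> by simp
        moreover have "length ps + j < i" "length ps + k < i"
          using 2 \<open>i = length ps + i'\<close> by simp_all
        ultimately show ?thesis by blast
      qed
    next
      case 3
      \<comment> \<open>The new last entry follows from the last entries of the two proofs; as both
        lists are nonempty, these positions exist and precede it.\<close>
      have "?rs ! (length ps - 1) = Imp \<phi> \<psi>"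
        using ps(1,2) by (simp add: nth_append last_conv_nth)
      moreover have "?rs ! (length ps + (length qs - 1)) = \<phi>"
        using qs(1,2) by (simp add: nth_append last_conv_nth)
      moreover have "?rs ! i = \<psi>" using 3 by (simp add: nth_append)
      ultimately have "?rs ! (length ps - 1) = Imp (?rs ! (length ps + (length qs - 1))) (?rs ! i)"
        by simp
      moreover have "length ps - 1 < i" "length ps + (length qs - 1) < i"
        using 3 ps(1) qs(1) by (cases ps; cases qs; simp)+
      ultimately show ?thesis by blast
    qed
  qed
  then have "proof_of L T ?rs \<psi>" unfolding proof_of_def by auto
  then show ?thesis unfolding provable_def by blast
qed

text \<open>Replaces proof lists by rule induction: strong induction on positions gives the property
  for every entry, in particular for the last.\<close>

lemma provable_induct [consumes 1, case_names ax mp]: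
  assumes "provable L T \<phi>"
    and ax: "\<And>\<phi>. \<phi> \<in> T \<or> log_ax L \<phi> \<Longrightarrow> P \<phi>"
    and mp: "\<And>\<phi> \<psi>. P (Imp \<phi> \<psi>) \<Longrightarrow> P \<phi> \<Longrightarrow> P \<psi>"
  shows "P \<phi>"
proof -
  obtain ps where ps: "proof_of L T ps \<phi>"
    using assms(1) unfolding provable_def by blast
  have "P (ps ! i)" if "i < length ps" for i
    using that
  proof (induction i rule: less_induct)
    case (less i)
    consider "ps ! i \<in> T \<or> log_ax L (ps ! i)"
      | j k where "j < i" "k < i" "ps ! j = Imp (ps ! k) (ps ! i)"
      using ps less.prems unfolding proof_of_def by blast
    then show ?case
    proof cases
      case 1
      then show ?thesis by (rule ax)
    next
      case (2 j k)
      then have "P (Imp (ps ! k) (ps ! i))" "P (ps ! k)"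
        using less.IH[of j] less.IH[of k] less.prems by simp_all
      then show ?thesis by (rule mp)
    qed
  qed
  moreover have "ps \<noteq> []" "\<phi> = ps ! (length ps - 1)"
    using ps unfolding proof_of_def by (auto simp: last_conv_nth)
  ultimately show ?thesis by simp
qed

lemma log_ax_is_fm: "log_ax L \<phi> \<Longrightarrow> is_fm L \<phi>"
  by (induction rule: log_ax.induct) (auto simp: shift_def intro: is_fm_sub is_fm_inst)

section \<open>Derived rules for theories whose axioms are sentences\<close>

locale closed_theory =
  fixes L :: lang and T :: "fm set"
  assumes sentences: "\<And>\<alpha>. \<alpha> \<in> T \<Longrightarrow> sentence L \<alpha>"
begin

lemma provable_is_fm: "provable L T \<phi> \<Longrightarrow> is_fm L \<phi>"
  by (induction rule: provable_induct) (auto simp: sentence_def log_ax_is_fm dest: sentences)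

lemma taut0: "tautology \<phi> \<Longrightarrow> is_fm L \<phi> \<Longrightarrow> provable L T \<phi>"
  by (simp add: provable_ax log_ax.taut)

text \<open>With its two successors, this draws any propositional consequence in one step. Only the
  conclusion needs a check of well-formedness; provable premises are well-formed already.\<close>

lemma taut1:
  assumes "provable L T \<phi>" "tautology (Imp \<phi> \<psi>)" "is_fm L \<psi>"
  shows "provable L T \<psi>"
  using assms provable_mp taut0 provable_is_fm is_fm.simps(4) by blast

lemma taut2:
  assumes "provable L T \<phi>" "provable L T \<chi>" "tautology (Imp \<phi> (Imp \<chi> \<psi>))" "is_fm L \<psi>"
  shows "provable L T \<psi>"
  using assms taut1 provable_mp provable_is_fm is_fm.simps(4) by blast

lemma taut3:
  assumes "provable L T \<phi>" "provable L T \<chi>" "provable L T \<xi>"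
    and "tautology (Imp \<phi> (Imp \<chi> (Imp \<xi> \<psi>)))" "is_fm L \<psi>"
  shows "provable L T \<psi>"
  using assms taut2 provable_mp provable_is_fm is_fm.simps(4) by blast

text \<open>Generalization is not a rule of the calculus. It is admissible because logical axioms
  are closed under it, axioms of \<open>T\<close> are closed formulas, and \<open>dist\<close>
  carries it through modus ponens.\<close>

lemma provable_All:
  assumes "provable L T \<phi>"
  shows "provable L T (All \<phi>)"
proof -
  \<comment> \<open>The first conjunct is carried along because the modus ponens case needs
    well-formedness of its premises for \<open>dist\<close>.\<close>
  have "provable L T \<phi> \<and> provable L T (All \<phi>)"
    using assms
  proof (induction rule: provable_induct)
    case (ax \<phi>)
    show ?case
    proof (cases "log_ax L \<phi>")
      case True
      then show ?thesis by (simp add: provable_ax log_ax.gen)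
    next
      case False
      with ax have "\<phi> \<in> T" by blast
      \<comment> \<open>A sentence equals its own shift, so \<open>vacuous\<close> yields its
        generalization.\<close>
      then have "is_fm L \<phi>" "shift \<phi> = \<phi>" "provable L T \<phi>"
        using sentences by (auto simp: sentence_def shift_def sub_closed provable_ax)
      then show ?thesis
        using log_ax.vacuous[of L \<phi>] provable_ax provable_mp by metis
    qed
  next
    case (mp \<phi> \<psi>)
    then have "is_fm L \<phi>" "is_fm L \<psi>"
      using provable_is_fm by fastforce+
    then have "provable L T (Imp (All (Imp \<phi> \<psi>)) (Imp (All \<phi>) (All \<psi>)))"
      by (simp add: provable_ax log_ax.dist)
    then show ?case using mp provable_mp by blast
  qed
  then show ?thesis ..
qed

lemma provable_spec:
  assumes "provable L T (All \<phi>)" "is_tm L t"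
  shows "provable L T (sub (point t) \<phi>)"
proof -
  have "is_fm L \<phi>" using provable_is_fm[OF assms(1)] by simp
  then have "provable L T (Imp (All \<phi>) (sub (point t) \<phi>))"
    using assms(2) log_ax.spec by (auto simp: provable_ax simp flip: inst_single)
  then show ?thesis using assms(1) provable_mp by blast
qed

lemma provable_spec_imp:
  assumes "is_fm L \<phi>" "is_tm L t"
  shows "provable L T (Imp (All \<phi>) (sub (point t) \<phi>))"
  using assms log_ax.spec by (auto simp: provable_ax simp flip: inst_single)

lemma is_fm_point: "is_fm L \<phi> \<Longrightarrow> is_tm L t \<Longrightarrow> is_fm L (sub (point t) \<phi>)"
  by (rule is_fm_sub) (auto simp: point_def split: nat.split)

lemma provable_Exists:
  assumes "is_fm L \<phi>" "is_tm L t"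
  shows "provable L T (Imp (sub (point t) \<phi>) (Exists \<phi>))"
proof -
  have "provable L T (Imp (All (Neg \<phi>)) (Neg (sub (point t) \<phi>)))"
    using provable_spec_imp[of "Neg \<phi>" t] assms by simp
  then show ?thesis
    by (rule taut1) (use assms in \<open>auto simp: tautology_def is_fm_point\<close>)
qed

lemma provable_not_Exists:
  assumes "provable L T (Neg \<phi>)"
  shows "provable L T (Neg (Exists \<phi>))"
  using provable_All[OF assms]
  by (rule taut1) (use provable_is_fm[OF assms] in \<open>auto simp: tautology_def\<close>)

text \<open>Leibniz is applied to the negation of the formula and contraposed, which avoids proving
  symmetry of equality. With 0 as the only possible free variable, instantiating by
  \<open>Var 0\<close> changes nothing; other variables would be lowered.\<close>

lemma replace_by_equal:
  assumes "fv \<phi> \<subseteq> {0}" "is_fm L \<phi>" "is_tm L t" "provable L T (sub (point t) \<phi>)"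
  shows "provable L T (Imp (Eq (Var 0) t) \<phi>)"
proof -
  have "inst (Neg \<phi>) [Var 0] = Neg \<phi>"
  proof -
    have "sub (point (Var 0)) \<phi> = sub Var \<phi>"
      by (rule sub_cong) (use assms(1) in auto)
    then show ?thesis by (simp add: inst_single sub_Var)
  qed
  then have "provable L T (Imp (Eq (Var 0) t) (Imp (Neg \<phi>) (Neg (sub (point t) \<phi>))))"
    using log_ax.leibniz[of L "Neg \<phi>" "Var 0" t] assms
    by (simp add: provable_ax inst_single)
  with assms(4) show ?thesis
    by (rule taut2) (use assms in \<open>auto simp: tautology_def\<close>)
qed

lemma big_or_elim:
  assumes "\<And>i. i \<le> n \<Longrightarrow> provable L T (Imp (F i) \<phi>)"
  shows "provable L T (Imp (big_or F n) \<phi>)"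
  using assms
proof (induction n)
  case (Suc n)
  then have prov: "provable L T (Imp (big_or F n) \<phi>)" "provable L T (Imp (F (Suc n)) \<phi>)"
    by simp_all
  then have "is_fm L (big_or F (Suc n))" "is_fm L \<phi>"
    using provable_is_fm by fastforce+
  then show ?case
    by (intro taut2[OF prov]) (auto simp: tautology_def)
qed simp

end

section \<open>Bounded provability of instances\<close>

text \<open>The formula S of the overview, with terms for its variables, so that substitution acts
  on the arguments alone. In the innermost scope \<open>Var 1\<close> is the proof code u and
  \<open>Var 0\<close> the formula code c; arguments are lifted once per quantifier crossed.\<close>

definition bounded_proof :: "nat \<Rightarrow> fm \<Rightarrow> fm \<Rightarrow> tm \<Rightarrow> tm \<Rightarrow> tm \<Rightarrow> fm" where
  "bounded_proof le G P s t r =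
     Exists (And (Rel le [Var 0, lift r])
       (Exists (And (Rel le [Var 0, lift (lift r)])
         (And (inst G [lift (lift s), lift (lift t), Var 0]) (inst P [Var 1, Var 0])))))"

text \<open>The matrix of the Rosser-style formula without its leading quantifier. Keeping z as the
  argument \<open>r\<close> allows both a numeral witness and a variable.\<close>

definition rosser_body :: "nat \<Rightarrow> fm \<Rightarrow> fm \<Rightarrow> tm \<Rightarrow> tm \<Rightarrow> tm \<Rightarrow> fm" where
  "rosser_body le G P s t r =
     And (bounded_proof le G P s t r)
       (All (Imp (And (Rel le [Var 0, lift r]) (bounded_proof le G P (lift s) (Var 0) (lift r)))
         (Eq (Var 0) (lift t))))"

section \<open>Bounded quantifiers over numerals\<close>

locale arithmetic = closed_theory +
  fixes le :: nat and num :: "nat \<Rightarrow> tm"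
  assumes leq_symbol: "rel_ar L le = Some 2"
    and numerals: "\<And>n. closed_tm L (num n)"
    and num_neq: "\<And>i j. i \<noteq> j \<Longrightarrow> provable L T (Neg (Eq (num i) (num j)))"
    and num_le: "\<And>n m. n \<le> m \<Longrightarrow> provable L T (Rel le [num n, num m])"
    and num_le_trans: "\<And>n m. n \<le> m \<Longrightarrow>
      provable L T (All (Imp (Rel le [num m, Var 0]) (Rel le [num n, Var 0])))"
    and num_total: "\<And>n. provable L T (All (Or (Rel le [Var 0, num n]) (Rel le [num n, Var 0])))"
    and num_below: "\<And>n. provable L T
      (All (Iff (Rel le [Var 0, num n]) (big_or (\<lambda>i. Eq (Var 0) (num i)) n)))"
begin

lemma is_tm_num [simp]: "is_tm L (num n)"
  using numerals by (simp add: closed_tm_def)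

lemma fvt_num [simp]: "fvt (num n) = {}"
  using numerals by (simp add: closed_tm_def)

lemma subt_num [simp]: "subt \<sigma> (num n) = num n"
  by (simp add: subt_closed)

lemma lift_num [simp]: "lift (num n) = num n"
  by (simp add: lift_def)

lemma rel_ar_le [simp]: "rel_ar L le = Some (Suc (Suc 0))"
  using leq_symbol by (simp add: numeral_2_eq_2)

lemma sub_big_or: "sub \<sigma> (big_or F n) = big_or (\<lambda>i. sub \<sigma> (F i)) n"
  by (induction n) auto

text \<open>Property (c) turns the bound into a finite disjunction of equations, and each disjunct
  is settled by replacing the variable by its numeral.\<close>

lemma bounded_cases:
  assumes "fv \<phi> \<subseteq> {0}" "is_fm L \<phi>" "\<And>i. i \<le> n \<Longrightarrow> provable L T (sub (point (num i)) \<phi>)"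
  shows "provable L T (Imp (Rel le [Var 0, num n]) \<phi>)"
proof -
  \<comment> \<open>Instantiating by \<open>Var 0\<close> strips the quantifier and leaves the body
    as it is.\<close>
  have "provable L T (Iff (Rel le [Var 0, num n]) (big_or (\<lambda>i. Eq (Var 0) (num i)) n))"
    using provable_spec[OF num_below, of "Var 0" n] by (simp add: sub_big_or)
  moreover have "provable L T (Imp (big_or (\<lambda>i. Eq (Var 0) (num i)) n) \<phi>)"
    by (rule big_or_elim) (use assms in \<open>auto intro: replace_by_equal\<close>)
  ultimately show ?thesis
    by (rule taut2) (use assms in \<open>auto simp: tautology_def\<close>)
qed

lemma bounded_Exists_refute:
  assumes "fv \<phi> \<subseteq> {0}" "is_fm L \<phi>"
    and "\<And>i. i \<le> n \<Longrightarrow> provable L T (Neg (sub (point (num i)) \<phi>))"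
  shows "provable L T (Neg (Exists (And (Rel le [Var 0, num n]) \<phi>)))"
proof (rule provable_not_Exists)
  have "provable L T (Imp (Rel le [Var 0, num n]) (Neg \<phi>))"
    by (rule bounded_cases) (use assms in auto)
  then show "provable L T (Neg (And (Rel le [Var 0, num n]) \<phi>))"
    by (rule taut1) (use assms in \<open>auto simp: tautology_def\<close>)
qed

lemma le_num_mono:
  assumes "n \<le> m" "is_tm L t"
  shows "provable L T (Imp (Rel le [num m, t]) (Rel le [num n, t]))"
  using provable_spec[OF num_le_trans, OF assms] by simp

end

section \<open>The Rosser-style formula: proving and refuting its instances\<close>

locale rosser = arithmetic +
  fixes G P :: fm
  assumes G: "is_fm L G" "fv G \<subseteq> {0, 1, 2}"
    and P: "is_fm L P" "fv P \<subseteq> {0, 1}"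
begin

abbreviation "S \<equiv> bounded_proof le G P"

abbreviation "R \<equiv> rosser_body le G P"

lemma sub_inst_G [simp]: "sub \<sigma> (inst G [a, b, c]) = inst G [subt \<sigma> a, subt \<sigma> b, subt \<sigma> c]"
  using G(2) by (subst sub_inst) auto

lemma sub_inst_P [simp]: "sub \<sigma> (inst P [a, b]) = inst P [subt \<sigma> a, subt \<sigma> b]"
  using P(2) by (subst sub_inst) auto

lemma is_fm_inst_G [simp]:
  "is_tm L a \<Longrightarrow> is_tm L b \<Longrightarrow> is_tm L c \<Longrightarrow> is_fm L (inst G [a, b, c])"
  using G(1) by (auto intro: is_fm_inst)

lemma is_fm_inst_P [simp]: "is_tm L a \<Longrightarrow> is_tm L b \<Longrightarrow> is_fm L (inst P [a, b])"
  using P(1) by (auto intro: is_fm_inst)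

lemma fv_inst_G: "fv (inst G [a, b, c]) \<subseteq> fvt a \<union> fvt b \<union> fvt c"
  using fv_inst[of G "[a, b, c]"] G(2) by fastforce

lemma fv_inst_P: "fv (inst P [a, b]) \<subseteq> fvt a \<union> fvt b"
  using fv_inst[of P "[a, b]"] P(2) by fastforce

lemma sub_S [simp]: "sub \<sigma> (S s t r) = S (subt \<sigma> s) (subt \<sigma> t) (subt \<sigma> r)"
  by (simp add: bounded_proof_def)

lemma is_fm_S [simp]: "is_tm L s \<Longrightarrow> is_tm L t \<Longrightarrow> is_tm L r \<Longrightarrow> is_fm L (S s t r)"
  by (simp add: bounded_proof_def)

lemma fv_S: "fv (S s t r) \<subseteq> fvt s \<union> fvt t \<union> fvt r"
proof -
  have "i \<in> fvt s \<union> fvt t \<union> fvt r"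
    if "Suc (Suc i) \<in> fv (inst G [lift (lift s), lift (lift t), Var 0])" for i
    using that fv_inst_G[of "lift (lift s)" "lift (lift t)" "Var 0"] by (auto simp: fvt_lift)
  moreover have "Suc (Suc i) \<notin> fv (inst P [Var (Suc 0), Var 0])" for i
    using fv_inst_P[of "Var (Suc 0)" "Var 0"] by auto
  ultimately show ?thesis
    by (auto simp: bounded_proof_def fvt_lift)
qed

text \<open>With a numeral as bound, both quantifiers range over finitely many numerals. For each
  pair, either \<open>c\<close> is the wrong code and \<open>G\<close> is refuted, or it is
  \<open>g\<close> and the proof predicate is refuted.\<close>

lemma S_refute:
  assumes G_code: "\<And>c. c \<noteq> g \<Longrightarrow> provable L T (Neg (inst G [num n, num m, num c]))"
    and no_proof: "\<And>k. provable L T (Neg (inst P [num k, num g]))"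
  shows "provable L T (Neg (S (num n) (num m) (num i)))"
proof -
  \<comment> \<open>The inner quantifier is refuted first, with a numeral for the proof code; this
    supplies the cases for the outer one.\<close>
  have "provable L T (Neg (Exists (And (Rel le [Var 0, num i])
      (And (inst G [num n, num m, Var 0]) (inst P [num j, Var 0])))))" for j
  proof (rule bounded_Exists_refute)
    fix c
    have "provable L T (Neg (And (inst G [num n, num m, num c]) (inst P [num j, num c])))"
    proof (cases "c = g")
      case True
      show ?thesis
        by (rule taut1[OF no_proof[of j]]) (auto simp: True tautology_def)
    next
      case False
      show ?thesis
        by (rule taut1[OF G_code[OF False]]) (auto simp: tautology_def)
    qed
    then show "provable L T (Neg (sub (point (num c))
        (And (inst G [num n, num m, Var 0]) (inst P [num j, Var 0]))))"
      by simp
  qed (use fv_inst_G[of "num n" "num m" "Var 0"] fv_inst_P[of "num j" "Var 0"] in auto)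
  then show ?thesis
    unfolding bounded_proof_def lift_num
    by (intro bounded_Exists_refute)
      (use fv_inst_G[of "num n" "num m" "Var 0"] fv_inst_P[of "Var (Suc 0)" "Var 0"] in auto)
qed

text \<open>The witnesses are the numerals of \<open>k\<close> and \<open>g\<close>, whose bounds
  follow from \<open>w\<close> being below \<open>r\<close> by (a). The term \<open>r\<close> is
  arbitrary, as the result is needed for a numeral and for a variable z.\<close>

lemma S_intro:
  assumes "g \<le> w" "k \<le> w" "is_tm L r"
    and "provable L T (inst G [num n, num m, num g])" "provable L T (inst P [num k, num g])"
  shows "provable L T (Imp (Rel le [num w, r]) (S (num n) (num m) r))"
proof -
  let ?A = "\<lambda>u. And (Rel le [Var 0, lift r])
    (And (inst G [num n, num m, Var 0]) (inst P [u, Var 0]))"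
  have "provable L T (Imp (sub (point (num g)) (?A (num k))) (Exists (?A (num k))))"
    by (rule provable_Exists) (use assms(3) in auto)
  then have "provable L T (Imp (And (Rel le [num g, r])
      (And (inst G [num n, num m, num g]) (inst P [num k, num g]))) (Exists (?A (num k))))"
    by simp
  then have "provable L T (Imp (And (inst G [num n, num m, num g]) (inst P [num k, num g]))
      (Imp (Rel le [num w, r]) (Exists (?A (num k)))))"
    by (rule taut2[OF le_num_mono[OF assms(1,3)]]) (use assms(3) in \<open>auto simp: tautology_def\<close>)
  then have inner: "provable L T (Imp (Rel le [num w, r]) (Exists (?A (num k))))"
    by (rule taut3[OF assms(4,5)]) (use assms(3) in \<open>auto simp: tautology_def\<close>)
  let ?B = "And (Rel le [Var 0, lift r]) (Exists (And (Rel le [Var 0, lift (lift r)])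
         (And (inst G [num n, num m, Var 0]) (inst P [Var 1, Var 0]))))"
  \<comment> \<open>Putting \<open>num k\<close> for the outer variable turns the inner existential
    of \<open>?B\<close> into that of \<open>?A (num k)\<close>.\<close>
  have "provable L T (Imp (sub (point (num k)) ?B) (Exists ?B))"
    by (rule provable_Exists) (use assms(3) in auto)
  then have "provable L T (Imp (And (Rel le [num k, r]) (Exists (?A (num k)))) (Exists ?B))"
    by simp
  then have "provable L T (Imp (Rel le [num w, r]) (Exists ?B))"
    by (rule taut3[OF le_num_mono[OF assms(2,3)] inner])
      (use assms(3) in \<open>auto simp: tautology_def\<close>)
  then show ?thesis by (simp add: bounded_proof_def)
qed

lemma sub_R [simp]: "sub \<sigma> (R s t r) = R (subt \<sigma> s) (subt \<sigma> t) (subt \<sigma> r)"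
  by (simp add: rosser_body_def)

lemma is_fm_R [simp]: "is_tm L s \<Longrightarrow> is_tm L t \<Longrightarrow> is_tm L r \<Longrightarrow> is_fm L (R s t r)"
  by (simp add: rosser_body_def)

lemma fv_R: "fv (R s t r) \<subseteq> fvt s \<union> fvt t \<union> fvt r"
  using fv_S[of s t r] fv_S[of "lift s" "Var 0" "lift r"]
  by (auto simp: rosser_body_def fvt_lift)

lemma R_prove:
  assumes S: "\<And>r. is_tm L r \<Longrightarrow> provable L T (Imp (Rel le [num w, r]) (S (num n) (num m) r))"
    and not_S: "\<And>i. i \<noteq> m \<Longrightarrow> provable L T (Neg (S (num n) (num i) (num w)))"
  shows "provable L T (Exists (R (num n) (num m) (Var 0)))"
proof -
  have "provable L T (S (num n) (num m) (num w))"
    using provable_mp[OF S num_le] by simp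
  moreover have "provable L T (All (Imp (And (Rel le [Var 0, num w]) (S (num n) (Var 0) (num w)))
      (Eq (Var 0) (num m))))"
  proof (rule provable_All)
    have "provable L T (Imp (Rel le [Var 0, num w])
        (Imp (S (num n) (Var 0) (num w)) (Eq (Var 0) (num m))))"
    \<comment> \<open>As z is the numeral of \<open>w\<close>, the competitors y' are numerals too:
      \<open>m\<close> itself satisfies the equation by reflexivity, any other makes
      \<open>S\<close> refutable.\<close>
    proof (rule bounded_cases)
      fix i
      have "provable L T (Imp (S (num n) (num i) (num w)) (Eq (num i) (num m)))"
      proof (cases "i = m")
        case True
        have "provable L T (Eq (num m) (num m))"
          by (simp add: provable_ax log_ax.refl)
        then show ?thesis
          by (rule taut1) (auto simp: True tautology_def)
      next
        case False
        show ?thesis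
          by (rule taut1[OF not_S[OF False]]) (auto simp: tautology_def)
      qed
      then show "provable L T (sub (point (num i))
          (Imp (S (num n) (Var 0) (num w)) (Eq (Var 0) (num m))))"
        by simp
    qed (use fv_S[of "num n" "Var 0" "num w"] in auto)
    then show "provable L T (Imp (And (Rel le [Var 0, num w]) (S (num n) (Var 0) (num w)))
        (Eq (Var 0) (num m)))"
      by (rule taut1) (auto simp: tautology_def)
  qed
  ultimately have "provable L T (R (num n) (num m) (num w))"
    unfolding rosser_body_def lift_num by (rule taut2) (auto simp: tautology_def)
  then show ?thesis
    using provable_mp provable_Exists[of "R (num n) (num m) (Var 0)" "num w"] by simp
qed

text \<open>Nothing bounds z here, so (b) splits at \<open>w\<close>. Below, \<open>S\<close> for
  \<open>m\<close> fails numeral by numeral; above, \<open>m0\<close> is a competitor within the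
  bound z and would have to equal \<open>m\<close>, against (a).\<close>

lemma R_refute:
  assumes "m0 \<le> w" "m \<noteq> m0"
    and S: "\<And>r. is_tm L r \<Longrightarrow> provable L T (Imp (Rel le [num w, r]) (S (num n) (num m0) r))"
    and not_S: "\<And>i. provable L T (Neg (S (num n) (num m) (num i)))"
  shows "provable L T (Neg (Exists (R (num n) (num m) (Var 0))))"
proof (rule provable_not_Exists)
  let ?z = "Var 0"
  have S_z: "provable L T (Imp (Rel le [num w, ?z]) (S (num n) (num m0) ?z))"
    by (rule S) simp
  have m0_le_z: "provable L T (Imp (Rel le [num w, ?z]) (Rel le [num m0, ?z]))"
    by (rule le_num_mono[OF assms(1)]) simp
  \<comment> \<open>The body of the uniqueness conjunct; under its quantifier z becomes
    \<open>Var 1\<close>.\<close>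
  let ?U = "Imp (And (Rel le [Var 0, Var 1]) (S (num n) (Var 0) (Var 1))) (Eq (Var 0) (num m))"
  have "provable L T (Imp (Rel le [?z, num w]) (Neg (S (num n) (num m) ?z)))"
    by (rule bounded_cases) (use fv_S[of "num n" "num m" "Var 0"] not_S in auto)
  then have small: "provable L T (Imp (Rel le [?z, num w]) (Neg (R (num n) (num m) ?z)))"
    unfolding rosser_body_def lift_num
    by (rule taut1) (auto simp: tautology_def)
  \<comment> \<open>The competitor y' is taken to be \<open>num m0\<close>.\<close>
  have "provable L T (Imp (All ?U) (sub (point (num m0)) ?U))"
    by (rule provable_spec_imp) auto
  then have "provable L T (Imp (All ?U)
      (Imp (And (Rel le [num m0, ?z]) (S (num n) (num m0) ?z)) (Eq (num m0) (num m))))"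
    by simp
  then have "provable L T (Imp (And (Rel le [num m0, ?z]) (S (num n) (num m0) ?z)) (Neg (All ?U)))"
    by (rule taut2[OF num_neq[OF assms(2)[symmetric]]]) (auto simp: tautology_def)
  then have "provable L T (Imp (Rel le [num w, ?z]) (Neg (All ?U)))"
    by (rule taut3[OF m0_le_z S_z]) (auto simp: tautology_def)
  then have large: "provable L T (Imp (Rel le [num w, ?z]) (Neg (R (num n) (num m) ?z)))"
    unfolding rosser_body_def lift_num
    by (rule taut1) (auto simp: tautology_def)
  have "provable L T (Or (Rel le [?z, num w]) (Rel le [num w, ?z]))"
    using provable_spec[OF num_total, of "Var 0" w] by simp
  then show "provable L T (Neg (R (num n) (num m) ?z))"
    by (rule taut3[OF small large]) (auto simp: tautology_def)
qed

end

section \<open>From weak representability to representability\<close>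

theorem theorem3p10:
  fixes L :: lang and T :: "fm set" and le :: nat and num :: "nat \<Rightarrow> tm"
    and gn :: "fm \<Rightarrow> nat" and pn :: "fm list \<Rightarrow> nat" and Prf :: fm and f :: "nat \<Rightarrow> nat"
  defines "leq \<equiv> \<lambda>s t. Rel le [s, t]"
  assumes theory_T: "\<forall>\<alpha>\<in>T. sentence L \<alpha>"
    and leq_symbol: "rel_ar L le = Some 2"
    and numerals: "\<And>n. closed_tm L (num n)"
    and coding: "goedel_coding L gn pn"
    and coding_expressible: "instances_expressible L T num gn"
    and Prf: "is_fm L Prf" "fv Prf \<subseteq> {0, 1}"
    and a1: "\<And>i j. i \<noteq> j \<Longrightarrow> provable L T (Neg (Eq (num i) (num j)))"
    and a2: "\<And>n m. n \<le> m \<Longrightarrow> provable L T (leq (num n) (num m))"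
    and a3: "\<And>n m. n \<le> m \<Longrightarrow>
               provable L T (All (Imp (leq (num m) (Var 0)) (leq (num n) (Var 0))))"
    and b: "\<And>n. provable L T (All (Or (leq (Var 0) (num n)) (leq (num n) (Var 0))))"
    and c: "\<And>n. provable L T
               (All (Iff (leq (Var 0) (num n)) (big_or (\<lambda>i. Eq (Var 0) (num i)) n)))"
    and d: "\<And>\<phi> k. is_fm L \<phi> \<Longrightarrow> codes_proof L T pn k \<phi> \<Longrightarrow>
               provable L T (inst Prf [num k, num (gn \<phi>)])"
    and e: "\<And>\<phi> k. is_fm L \<phi> \<Longrightarrow> \<not> codes_proof L T pn k \<phi> \<Longrightarrow>
               provable L T (Neg (inst Prf [num k, num (gn \<phi>)]))"
    and weak: "weakly_representable L T num f"
  shows "representable L T num f"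
proof -
  obtain \<phi> where \<phi>: "is_fm L \<phi>" "fv \<phi> \<subseteq> {0, 1}"
    and yes: "\<And>n. provable L T (inst \<phi> [num n, num (f n)])"
    and no: "\<And>n m. f n \<noteq> m \<Longrightarrow> \<not> provable L T (inst \<phi> [num n, num m])"
    using weak unfolding weakly_representable_def by blast
  define g where "g n m = gn (inst \<phi> [num n, num m])" for n m
  obtain G where G: "is_fm L G" "fv G \<subseteq> {0, 1, 2}"
    and G_yes: "\<And>n m. provable L T (inst G [num n, num m, num (g n m)])"
    and G_no: "\<And>n m c. c \<noteq> g n m \<Longrightarrow> provable L T (Neg (inst G [num n, num m, num c]))"
    using coding_expressible \<phi> unfolding instances_expressible_def representable2_def g_def
    by metis
  interpret rosser L T le num G Prf
    using theory_T leq_symbol numerals a1 a2 a3 b c G Prf unfolding leq_def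
    by unfold_locales auto
  have inst_fm: "is_fm L (inst \<phi> [num n, num m])" for n m
    using is_tm_num by (intro is_fm_inst[OF \<phi>(1)]) auto
  have not_S: "provable L T (Neg (S (num n) (num m) (num i)))" if "m \<noteq> f n" for n m i
  proof (rule S_refute[OF G_no])
    \<comment> \<open>An unprovable instance has no proof at all, so (e) refutes the proof predicate
      at every numeral.\<close>
    have "\<not> codes_proof L T pn k (inst \<phi> [num n, num m])" for k
      using no[of n m] that unfolding codes_proof_def provable_def by auto
    then show "provable L T (Neg (inst Prf [num k, num (g n m)]))" for k
      unfolding g_def by (intro e inst_fm)
  qed
  have witness: "\<exists>w\<ge>f n. \<forall>r. is_tm L r \<longrightarrow>
      provable L T (Imp (Rel le [num w, r]) (S (num n) (num (f n)) r))" for n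
  proof -
    obtain k where "codes_proof L T pn k (inst \<phi> [num n, num (f n)])"
      using yes[of n] unfolding provable_def codes_proof_def by blast
    then have k: "provable L T (inst Prf [num k, num (g n (f n))])"
      unfolding g_def by (intro d inst_fm)
    \<comment> \<open>The sum dominates all three: the two codes are the witnesses in
      \<open>S_intro\<close>, and \<open>f n\<close> must lie below the bound in
      \<open>R_refute\<close>.\<close>
    let ?w = "f n + g n (f n) + k"
    have "\<forall>r. is_tm L r \<longrightarrow> provable L T (Imp (Rel le [num ?w, r]) (S (num n) (num (f n)) r))"
      using S_intro[OF _ _ _ G_yes k] by simp
    then show ?thesis by (intro exI[of _ ?w]) simp
  qed
  \<comment> \<open>The leading quantifier binds z as \<open>Var 0\<close>, which moves x and y to
    \<open>Var 1\<close> and \<open>Var 2\<close>.\<close>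
  let ?\<psi> = "Exists (R (Var 1) (Var 2) (Var 0))"
  have \<psi>_inst: "inst ?\<psi> [num n, num m] = Exists (R (num n) (num m) (Var 0))" for n m
    by (simp add: inst_def eval_nat_numeral)
  show ?thesis
    unfolding representable_def
  proof (intro exI conjI allI impI)
    show "is_fm L ?\<psi>" by simp
    show "fv ?\<psi> \<subseteq> {0, 1}"
      using fv_R[of "Var 1" "Var 2" "Var 0"] by auto
  next
    fix n m
    assume "f n = m"
    then show "provable L T (inst ?\<psi> [num n, num m])"
      unfolding \<psi>_inst using witness[of n] not_S[of _ n] R_prove by metis
  next
    fix n m
    assume "f n \<noteq> m"
    then show "provable L T (Neg (inst ?\<psi> [num n, num m]))"
      \<comment> \<open>Here the true value \<open>f n\<close> plays the part of
        \<open>m0\<close>.\<close>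
      unfolding \<psi>_inst using witness[of n] not_S[of m n] R_refute by metis
  qed
qed

end
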